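(* Let $d\ge 1$ and let $\mathbf{h}'$ and $\mathbf{h}''$ be two $d$-dimensional probability vectors such that $\mathbf{h}'$ strictly majorizes $\mathbf{h}''$, i.e. $\mathbf{h}'\succ\mathbf{h}''$. Then $T^{\mathbf{h}'}$ is stochastically smaller than $T^{\mathbf{h}''}$, i.e. $$\mathbb{P}(T^{\mathbf{h}'}\le n)\ \ge\ \mathbb{P}(T^{\mathbf{h}''}\le n)\qquad\text{for all integers } n\ge 1.$$
   Context: A vector $\mathbf{h}=(h_1,\dots,h_d)\in\mathbb{R}^d$ is a probability vector if $h_i\ge 0$ for all $i$ and $h_1+\cdots+h_d=1$. For two vectors $\mathbf{h}'=(h'_1,\dots,h'_d)$ and $\mathbf{h}''=(h''_1,\dots,h''_d)$, $\mathbf{h}'$ majorizes $\mathbf{h}''$ (written $\mathbf{h}'\succeq\mathbf{h}''$) if $\sum_{i=1}^j h'_{(i)}\ge\sum_{i=1}^j h''_{(i)}$ for $j=1,\dots,d-1$ and $\sum_{i=1}^d h'_{(i)}=\sum_{i=1}^d h''_{(i)}$, where $(h'_{(1)},\dots,h'_{(d)})$ is the permutation of $\mathbf{h}'$ in decreasing order, and similarly for $\mathbf{h}''$. $\mathbf{h}'$ strictly majorizes $\mathbf{h}''$ (written $\mathbf{h}'\succ\mathbf{h}''$) if $\mathbf{h}'\succeq\mathbf{h}''$ and $\mathbf{h}'$ is not a permutation of $\mathbf{h}''$. Let $\mathbf{0}_d$ be the zero vector and $\mathbf{e}_d^i$ the $i$-th standard unit vector of $\mathbb{Z}^d$. For a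 probability vector $\mathbf{h}=(h_1,\dots,h_d)$, $(S^{\mathbf{h}}_n)_{n\ge 0}$ is the random walk on $\mathbb{Z}^d$ with $S^{\mathbf{h}}_0=\mathbf{0}_d$ and $S^{\mathbf{h}}_n=X^{\mathbf{h}}_1+\cdots+X^{\mathbf{h}}_n$ for $n\ge1$, where the increments $X^{\mathbf{h}}_n$ are i.i.d. with $\mathbb{P}(X^{\mathbf{h}}_n=\mathbf{e}_d^i)=\mathbb{P}(X^{\mathbf{h}}_n=-\mathbf{e}_d^i)=\frac12 h_i$ for $i=1,\dots,d$. The first return time is $T^{\mathbf{h}}=\inf\{n\geq 1: S^{\mathbf{h}}_n=\mathbf{0}_d\}$ (with $\inf\emptyset=\infty$). *)

theory Defs
  imports "HOL-Probability.Probability"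
begin

definition probability_vector :: "real ^ 'd \<Rightarrow> bool" where
  "probability_vector h \<longleftrightarrow> (\<forall>i. h $ i \<ge> 0) \<and> (\<Sum>i\<in>UNIV. h $ i) = 1"

(* The list is 0-based: its entry at position i - 1 is the i-th largest component. *)
definition decreasing_rearrangement :: "real ^ 'd \<Rightarrow> real list" where
  "decreasing_rearrangement h =
     rev (sorted_list_of_multiset (image_mset (\<lambda>i. h $ i) (mset_set UNIV)))"

definition majorizes :: "real ^ 'd \<Rightarrow> real ^ 'd \<Rightarrow> bool" (infix "\<succeq>\<^sub>m" 50) where
  "h' \<succeq>\<^sub>m h'' \<longleftrightarrow>
     (\<forall>j\<in>{1..CARD('d) - 1}.
        (\<Sum>i=1..j. decreasing_rearrangement h' ! (i - 1))
          \<ge> (\<Sum>i=1..j. decreasing_rearrangement h'' ! (i - 1))) \<and>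
     (\<Sum>i=1..CARD('d). decreasing_rearrangement h' ! (i - 1))
       = (\<Sum>i=1..CARD('d). decreasing_rearrangement h'' ! (i - 1))"

definition strictly_majorizes :: "real ^ 'd \<Rightarrow> real ^ 'd \<Rightarrow> bool" (infix "\<succ>\<^sub>m" 50) where
  "h' \<succ>\<^sub>m h'' \<longleftrightarrow>
     h' \<succeq>\<^sub>m h'' \<and> \<not> (\<exists>p. p permutes (UNIV :: 'd set) \<and> h' = (\<chi> i. h'' $ p i))"

(* X 0 is unused. For a probability vector h the two mass equations determine the law of
   each increment, so the increments are identically distributed. *)
locale lattice_walk = prob_space M
  for M :: "'a measure" and h :: "real ^ 'd" and X :: "nat \<Rightarrow> 'a \<Rightarrow> int ^ 'd" +
  assumes indep_increments: "indep_vars (\<lambda>_. count_space UNIV) X {1..}"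
    and increment_pos: "n \<ge> 1 \<Longrightarrow> \<P>(\<omega> in M. X n \<omega> = axis i 1) = h $ i / 2"
    and increment_neg: "n \<ge> 1 \<Longrightarrow> \<P>(\<omega> in M. X n \<omega> = - axis i 1) = h $ i / 2"

definition walk_position :: "(nat \<Rightarrow> 'a \<Rightarrow> int ^ 'd) \<Rightarrow> nat \<Rightarrow> 'a \<Rightarrow> int ^ 'd" where
  "walk_position X n \<omega> = (\<Sum>k=1..n. X k \<omega>)"

definition first_return_time :: "(nat \<Rightarrow> 'a \<Rightarrow> int ^ 'd) \<Rightarrow> 'a \<Rightarrow> enat" where
  "first_return_time X \<omega> = Inf {enat n | n. n \<ge> 1 \<and> walk_position X n \<omega> = 0}"

end

theory Submission
  imports Defs "HOL-Computational_Algebra.Formal_Power_Series"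
begin

text \<open>
  Let \<open>u n\<close> and \<open>f n\<close> be the probabilities that the walk is at the origin, respectively returns for
  the first time, at time \<open>2 * n\<close>, and let \<open>U\<close> and \<open>F\<close> be their generating functions in \<open>z\<close>. Cutting a
  closed path at its first return gives \<open>U * (1 - F) = 1\<close>. For two walks, marked by one and two
  primes, this yields \<open>F' - F'' = (U' - U'') * (1 - F') * (1 - F'')\<close>, and the claim is that all
  coefficients of \<open>(F' - F'') / (1 - z)\<close> are nonnegative.

  The idea is to write \<open>1 / (1 - z) = C * C\<close>, where \<open>C\<close> is the generating function of the return
  probabilities \<open>c n = (2 * n choose n) / 4 ^ n\<close> of the simple random walk on the integers, so that
  \<open>(F' - F'') / (1 - z) = (U' - U'') * (C * (1 - F')) * (C * (1 - F''))\<close>.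
  All three factors have nonnegative coefficients, for the following two reasons.

  First, \<open>u n\<close> grows under majorization (\<open>return_prob_even_mono_majorizes\<close>). Fourier inversion
  (\<open>return_prob_fourier\<close>) writes it as an average of \<open>2 * n\<close>-th powers of linear forms in \<open>h\<close>, hence it
  is convex in \<open>h\<close>; it is also symmetric, and a vector majorized by \<open>h'\<close> lies in the convex
  hull of the permutations of \<open>h'\<close> (\<open>majorized_in_convex_hull_permutations\<close>).

  Second, \<open>C * (1 - F)\<close> has nonnegative coefficients for every walk
  (\<open>first_return_line_convolution_le\<close>). The one-step characteristic function is the real part of
  \<open>Z = (\<Sum>i. h $ i * \<omega> i)\<close> with \<open>\<omega> i\<close> on the unit circle. Rotating all \<open>\<omega> i\<close> together shows
  \<open>u n = c n * s n\<close>, where \<open>s n\<close> is the mean of \<open>norm Z ^ (2 * n)\<close> (\<open>return_prob_even\<close>). As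
  \<open>norm Z \<le> 1\<close>, the ratio \<open>s n\<close> of \<open>u n\<close> to \<open>c n\<close> decreases with \<open>n\<close>. Comparing with the renewal equation
  \<open>u n = (\<Sum>k=1..n. f k * u (n - k))\<close> gives \<open>(\<Sum>k=1..n. f k * c (n - k)) \<le> c n\<close>.

  The Fourier averages are taken over \<open>N\<close>-th roots of unity with \<open>N\<close> large, so that all sums are finite.
\<close>

section \<open>Closed lattice paths and the renewal equation\<close>

text \<open>
  A step is a coordinate together with a sign, so that the steps form a finite type and
  the first \<open>n\<close> increments of the walk become a word of length \<open>n\<close>.
\<close>
definition step_vector :: "'d \<times> bool \<Rightarrow> int ^ 'd" where
  "step_vector s = (if snd s then axis (fst s) 1 else - axis (fst s) 1)"

definition displacement :: "('d::finite \<times> bool) list \<Rightarrow> int ^ 'd" where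
  "displacement xs = (\<Sum>s\<leftarrow>xs. step_vector s)"

definition path_weight :: "real ^ 'd \<Rightarrow> ('d::finite \<times> bool) list \<Rightarrow> real" where
  "path_weight h xs = (\<Prod>s\<leftarrow>xs. h $ fst s / 2)"

definition first_return :: "('d::finite \<times> bool) list \<Rightarrow> bool" where
  "first_return xs \<longleftrightarrow> xs \<noteq> [] \<and> displacement xs = 0 \<and>
     (\<forall>k\<in>{1..<length xs}. displacement (take k xs) \<noteq> 0)"

definition return_prob :: "real ^ 'd \<Rightarrow> nat \<Rightarrow> real" where
  "return_prob h n = (\<Sum>xs | length xs = n \<and> displacement xs = 0. path_weight h xs)"

definition first_return_prob :: "real ^ 'd \<Rightarrow> nat \<Rightarrow> real" where
  "first_return_prob h n = (\<Sum>xs | length xs = n \<and> first_return xs. path_weight h xs)"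

lemma displacement_Nil [simp]: "displacement [] = 0"
  by (simp add: displacement_def)

lemma displacement_Cons [simp]: "displacement (s # xs) = step_vector s + displacement xs"
  by (simp add: displacement_def)

lemma displacement_append [simp]: "displacement (xs @ ys) = displacement xs + displacement ys"
  by (simp add: displacement_def)

lemma path_weight_Nil [simp]: "path_weight h [] = 1"
  by (simp add: path_weight_def)

lemma path_weight_append: "path_weight h (xs @ ys) = path_weight h xs * path_weight h ys"
  by (simp add: path_weight_def)

lemma path_weight_nonneg: "probability_vector h \<Longrightarrow> path_weight h xs \<ge> 0"
  by (induction xs) (auto simp: path_weight_def probability_vector_def)

lemma finite_lists_of_length [simp]: "finite {xs :: ('d::finite \<times> bool) list. length xs = n \<and> P xs}"
  by (rule finite_subset[OF _ finite_lists_length_eq[of UNIV n]]) auto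

lemma first_return_prob_nonneg: "probability_vector h \<Longrightarrow> first_return_prob h n \<ge> 0"
  unfolding first_return_prob_def by (intro sum_nonneg path_weight_nonneg)

lemma return_prob_0 [simp]:
  fixes h :: "real ^ 'd"
  shows "return_prob h 0 = 1"
proof -
  have "{xs :: ('d \<times> bool) list. length xs = 0 \<and> displacement xs = 0} = {[]}" by auto
  then show ?thesis by (simp only: return_prob_def) simp
qed

lemma first_return_prob_0 [simp]: "first_return_prob h 0 = 0"
  unfolding first_return_prob_def first_return_def by (rule sum.neutral) auto

text \<open>
  A closed path splits uniquely into its portion up to the first return and a closed
  remainder; weights are multiplicative under this splitting.
\<close>
lemma renewal_equation:
  fixes h :: "real ^ 'd"
  assumes "n \<ge> 1"
  shows "return_prob h n = (\<Sum>k=1..n. first_return_prob h k * return_prob h (n - k))"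
proof -
  define F where "F k = {xs :: ('d \<times> bool) list. length xs = k \<and> first_return xs}" for k
  define R where "R k = {xs :: ('d \<times> bool) list. length xs = k \<and> displacement xs = 0}" for k
  define t where "t xs = (LEAST k. 1 \<le> k \<and> displacement (take k xs) = 0)" for xs :: "('d \<times> bool) list"
  have t_prop: "1 \<le> t xs \<and> t xs \<le> n \<and> displacement (take (t xs) xs) = 0 \<and>
      (\<forall>k. 1 \<le> k \<longrightarrow> k < t xs \<longrightarrow> displacement (take k xs) \<noteq> 0)" if "xs \<in> R n" for xs
  proof -
    have ex: "1 \<le> n \<and> displacement (take n xs) = 0" using that assms by (simp add: R_def)
    show ?thesis
      using LeastI[of "\<lambda>k. 1 \<le> k \<and> displacement (take k xs) = 0", OF ex]
        Least_le[of "\<lambda>k. 1 \<le> k \<and> displacement (take k xs) = 0", OF ex]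
        not_less_Least[of _ "\<lambda>k. 1 \<le> k \<and> displacement (take k xs) = 0"]
      unfolding t_def by blast
  qed
  have t_append: "t (ys @ zs) = k" if "ys \<in> F k" "1 \<le> k" for ys zs k
    unfolding t_def
  proof (rule Least_equality)
    show "1 \<le> k \<and> displacement (take k (ys @ zs)) = 0"
      using that by (auto simp: F_def first_return_def)
    fix j assume "1 \<le> j \<and> displacement (take j (ys @ zs)) = 0"
    then show "k \<le> j" using that by (cases "j < k") (auto simp: F_def first_return_def)
  qed
  have "(\<Sum>k=1..n. first_return_prob h k * return_prob h (n - k))
      = (\<Sum>k=1..n. \<Sum>(ys, zs)\<in>F k \<times> R (n - k). path_weight h ys * path_weight h zs)"
    unfolding first_return_prob_def return_prob_def F_def R_def
    by (simp add: sum_product sum.cartesian_product)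
  also have "\<dots> = (\<Sum>(k, ys, zs)\<in>(SIGMA k:{1..n}. F k \<times> R (n - k)). path_weight h ys * path_weight h zs)"
    by (subst sum.Sigma) (auto simp: F_def R_def)
  \<comment> \<open>Concatenation is a bijection; its inverse cuts a path at the first return \<open>t\<close>.\<close>
  also have "\<dots> = (\<Sum>xs\<in>R n. path_weight h xs)"
  proof (rule sum.reindex_bij_witness[where i = "\<lambda>xs. (t xs, take (t xs) xs, drop (t xs) xs)"
        and j = "\<lambda>(k, ys, zs). ys @ zs"], goal_cases)
    case (1 a)
    then show ?case using t_append by (auto simp: F_def)
  next
    case (2 a)
    then show ?case by (auto simp: F_def R_def first_return_def)
  next
    case (3 b)
    then show ?case by auto
  next
    case (4 b)
    have len: "length b = n" and d: "displacement b = 0" using 4 by (auto simp: R_def)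
    have "displacement (take (t b) b) + displacement (drop (t b) b) = 0"
      using d by (metis displacement_append append_take_drop_id)
    then show ?case using t_prop[OF 4] len
      by (auto simp: F_def R_def first_return_def min_def)
  next
    case (5 a)
    then show ?case by (auto simp: path_weight_append)
  qed
  finally show ?thesis by (simp add: return_prob_def R_def)
qed

text \<open>
  Every step changes the parity of the coordinate sum.
\<close>
lemma even_length_if_closed:
  fixes xs :: "('d::finite \<times> bool) list"
  assumes "displacement xs = 0"
  shows "even (length xs)"
proof -
  have "even (\<Sum>i\<in>UNIV. displacement xs $ i) \<longleftrightarrow> even (length xs)" for xs :: "('d \<times> bool) list"
  proof (induction xs)
    case (Cons s xs)
    have "(\<Sum>i\<in>UNIV. step_vector s $ i) = (if snd s then 1 else - 1)"
      by (simp add: step_vector_def axis_def sum_negf)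
    then show ?case using Cons by (simp add: sum.distrib)
  qed simp
  from this[of xs] assms show ?thesis by simp
qed

lemma first_return_prob_odd: "odd n \<Longrightarrow> first_return_prob h n = 0"
  unfolding first_return_prob_def
  by (rule sum.neutral) (auto simp: first_return_def dest: even_length_if_closed)

text \<open>
  Returns happen at even times only, so the renewal structure survives on the half-time scale
  \<open>n \<mapsto> 2 * n\<close>, on which the comparison with the walk on the integers takes place.
\<close>
lemma renewal_equation_even:
  assumes "n \<ge> 1"
  shows "return_prob h (2 * n) = (\<Sum>k=1..n. first_return_prob h (2 * k) * return_prob h (2 * (n - k)))"
proof -
  have "return_prob h (2 * n) = (\<Sum>k\<in>{1..2*n}. first_return_prob h k * return_prob h (2 * n - k))"
    using renewal_equation[of "2 * n" h] assms by simp
  also have "\<dots> = (\<Sum>k\<in>(*) 2 ` {1..n}. first_return_prob h k * return_prob h (2 * n - k))"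
  proof (rule sum.mono_neutral_right)
    show "\<forall>k\<in>{1..2 * n} - (*) 2 ` {1..n}. first_return_prob h k * return_prob h (2 * n - k) = 0"
    proof
      fix k assume k: "k \<in> {1..2 * n} - (*) 2 ` {1..n}"
      have "odd k"
      proof
        assume "even k"
        then obtain m where "k = 2 * m" by auto
        then show False using k by auto
      qed
      then show "first_return_prob h k * return_prob h (2 * n - k) = 0"
        by (simp add: first_return_prob_odd)
    qed
  qed auto
  also have "\<dots> = (\<Sum>k=1..n. first_return_prob h (2 * k) * return_prob h (2 * (n - k)))"
    by (subst sum.reindex) (auto simp: inj_on_def diff_mult_distrib2)
  finally show ?thesis .
qed

section \<open>Return probabilities by finite Fourier analysis\<close>

definition unity_roots :: "nat \<Rightarrow> complex set" where
  "unity_roots N = {z. z ^ N = 1}"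

text \<open>
  The characters of the discrete torus of side \<open>N\<close>. With \<open>N\<close> larger than the number of steps,
  this torus cannot be told apart from the lattice, and averaging over a finite set of phases
  replaces integration over a torus.
\<close>
definition phases :: "nat \<Rightarrow> ('d \<Rightarrow> complex) set" where
  "phases N = {\<omega>. \<forall>i. \<omega> i \<in> unity_roots N}"

text \<open>
  Its real part is the characteristic function of one step of the walk at the phase \<open>\<omega>\<close>. The
  complex number itself matters because multiplying all phases by a common root of unity turns it.
\<close>
definition rotor :: "real ^ 'd \<Rightarrow> ('d \<Rightarrow> complex) \<Rightarrow> complex" where
  "rotor h \<omega> = (\<Sum>i\<in>UNIV. h $ i *\<^sub>R \<omega> i)"

definition character :: "('d::finite \<Rightarrow> complex) \<Rightarrow> int ^ 'd \<Rightarrow> complex" where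
  "character \<omega> v = (\<Prod>i\<in>UNIV. \<omega> i powi (v $ i))"

lemma finite_unity_roots [simp]: "N > 0 \<Longrightarrow> finite (unity_roots N)"
  unfolding unity_roots_def by (rule finite_roots_unity) auto

lemma card_unity_roots: "N > 0 \<Longrightarrow> card (unity_roots N) = N"
  unfolding unity_roots_def by (rule card_roots_unity_eq)

lemma phases_eq_PiE: "phases N = (PiE UNIV (\<lambda>_. unity_roots N))"
  by (auto simp: phases_def PiE_def)

lemma finite_phases [simp]: "N > 0 \<Longrightarrow> finite (phases N :: ('d::finite \<Rightarrow> complex) set)"
  unfolding phases_eq_PiE by (rule finite_PiE) auto

lemma unity_root_norm:
  assumes "N > 0" "z \<in> unity_roots N"
  shows "norm z = 1"
proof -
  have "norm z ^ N = 1" using assms by (simp add: unity_roots_def flip: norm_power)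
  then show ?thesis using assms(1) by (intro power_eq_imp_eq_base[of "norm z" N 1]) auto
qed

text \<open>
  The sum is unchanged when every root is multiplied by a primitive root \<open>w\<close>, which multiplies it
  by \<open>w powi k\<close>; for \<open>0 < \<bar>k\<bar> < N\<close> this factor differs from 1.
\<close>
lemma sum_unity_roots_powi:
  assumes "N > 0" "\<bar>k\<bar> < int N"
  shows "(\<Sum>z\<in>unity_roots N. z powi k) = (if k = 0 then of_nat N else 0)"
proof (cases "k = 0")
  case True
  then show ?thesis using assms by (simp add: card_unity_roots)
next
  case False
  define w where "w = cis (2 * pi / real N)"
  have wN: "w ^ N = 1" using assms by (simp add: w_def Complex.DeMoivre)
  have w0: "w \<noteq> 0" by (simp add: w_def)
  have wm: "w ^ m \<noteq> 1" if "0 < m" "m < N" for m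
  proof
    assume "w ^ m = 1"
    then have eq: "cis (2 * pi * real m / real N) = cis (2 * pi * real 0 / real N)"
      by (simp add: w_def Complex.DeMoivre mult_ac)
    have inj: "inj_on (\<lambda>j. cis (2 * pi * real j / real N)) {..<N}"
      using Complex.bij_betw_roots_unity[OF assms(1)] by (simp add: bij_betw_def)
    have "m = 0" by (rule inj_onD[OF inj eq]) (use that in auto)
    then show False using that by simp
  qed
  have wk: "w powi k \<noteq> 1"
  proof (cases "k > 0")
    case True
    then show ?thesis using wm[of "nat k"] assms by (auto simp: power_int_def)
  next
    case neg: False
    then have "w ^ nat (-k) \<noteq> 1" using wm[of "nat (-k)"] assms False by auto
    then show ?thesis using neg False by (auto simp: power_int_def power_inverse)
  qed
  have "(\<Sum>z\<in>unity_roots N. z powi k) = (\<Sum>z\<in>unity_roots N. (w * z) powi k)"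
    by (rule sum.reindex_bij_witness[where i = "\<lambda>z. w * z" and j = "\<lambda>z. z / w"])
      (use w0 wN in \<open>auto simp: unity_roots_def power_mult_distrib power_divide\<close>)
  also have "\<dots> = w powi k * (\<Sum>z\<in>unity_roots N. z powi k)"
    by (simp add: power_int_mult_distrib sum_distrib_left)
  finally show ?thesis using wk False by simp
qed

lemma sum_character:
  fixes v :: "int ^ 'd::finite"
  assumes "N > 0" "\<And>i. \<bar>v $ i\<bar> < int N"
  shows "(\<Sum>\<omega>\<in>phases N. character \<omega> v) = (if v = 0 then of_nat N ^ CARD('d) else 0)"
proof -
  have "(\<Sum>\<omega>\<in>phases N. character \<omega> v) = (\<Prod>i\<in>UNIV. \<Sum>z\<in>unity_roots N. z powi (v $ i))"
    unfolding character_def phases_eq_PiE using assms(1) by (subst prod_sum_PiE) auto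
  also have "\<dots> = (\<Prod>i\<in>UNIV. if v $ i = 0 then of_nat N else 0)"
    using assms by (intro prod.cong) (simp_all add: sum_unity_roots_powi)
  also have "\<dots> = (if v = 0 then of_nat N ^ CARD('d) else 0)"
    by (auto simp: vec_eq_iff)
  finally show ?thesis .
qed

lemma phases_nonzero: "N > 0 \<Longrightarrow> \<omega> \<in> phases N \<Longrightarrow> \<omega> i \<noteq> 0"
  using unity_root_norm[of N "\<omega> i"] by (auto simp: phases_def)

lemma character_add:
  "(\<And>i. \<omega> i \<noteq> 0) \<Longrightarrow> character \<omega> (v + w) = character \<omega> v * character \<omega> w"
  by (simp add: character_def power_int_add prod.distrib)

lemma character_0 [simp]: "character \<omega> 0 = 1"
  by (simp add: character_def)

lemma inverse_eq_cnj:
  assumes "norm z = 1"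
  shows "inverse z = cnj z"
proof (rule inverse_unique)
  show "z * cnj z = 1" using assms by (simp flip: complex_norm_square)
qed

lemma character_step_vector:
  fixes s :: "'d::finite \<times> bool"
  assumes "\<And>i. norm (\<omega> i) = 1"
  shows "character \<omega> (step_vector s) = (if snd s then \<omega> (fst s) else cnj (\<omega> (fst s)))"
proof -
  have inv: "inverse (\<omega> i) = cnj (\<omega> i)" for i
    by (rule inverse_eq_cnj[OF assms])
  have "character \<omega> (step_vector s) = (\<Prod>i\<in>UNIV. if i = fst s then (if snd s then \<omega> i else cnj (\<omega> i)) else 1)"
    unfolding character_def step_vector_def
    by (intro prod.cong) (auto simp: axis_def power_int_minus inv)
  then show ?thesis by (simp add: prod.delta)
qed

lemma sum_lists_prod_list:
  fixes g :: "'s::finite \<Rightarrow> 'r::comm_semiring_1"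
  shows "(\<Sum>xs | length xs = n. \<Prod>s\<leftarrow>xs. g s) = (\<Sum>s\<in>UNIV. g s) ^ n"
proof (induction n)
  case (Suc n)
  have eq: "{xs :: 's list. length xs = Suc n} = (\<lambda>(s, xs). s # xs) ` (UNIV \<times> {xs. length xs = n})"
    by (auto simp: length_Suc_conv image_iff)
  have "(\<Sum>xs | length xs = Suc n. \<Prod>s\<leftarrow>xs. g s)
      = (\<Sum>(s, xs)\<in>UNIV \<times> {xs. length xs = n}. g s * (\<Prod>s\<leftarrow>xs. g s))"
    unfolding eq by (subst sum.reindex) (auto simp: inj_on_def intro!: sum.cong)
  also have "\<dots> = (\<Sum>s\<in>UNIV. g s) * (\<Sum>xs | length xs = n. \<Prod>s\<leftarrow>xs. g s)"
    by (simp add: sum_product sum.cartesian_product)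
  finally show ?case using Suc by simp
qed simp

lemma abs_displacement_le: "\<bar>displacement xs $ i\<bar> \<le> int (length xs)"
proof (induction xs)
  case (Cons s xs)
  have "\<bar>step_vector s $ i\<bar> \<le> 1" by (auto simp: step_vector_def axis_def)
  then show ?case using Cons abs_triangle_ineq[of "step_vector s $ i" "displacement xs $ i"] by simp
qed simp

text \<open>
  Characters turn displacements into products over the steps, so the sum over all words of
  length \<open>n\<close> factors into \<open>n\<close> copies of the one-step characteristic function.
\<close>
lemma sum_paths_character:
  assumes "N > 0" "\<omega> \<in> phases N"
  shows "(\<Sum>xs | length xs = n. of_real (path_weight h xs) * character \<omega> (displacement xs))
    = of_real (Re (rotor h \<omega>) ^ n)"
proof -
  define g where "g s = of_real (h $ fst s / 2) * character \<omega> (step_vector s)" for s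
  have nz: "\<omega> i \<noteq> 0" for i using phases_nonzero[OF assms] .
  have nrm: "norm (\<omega> i) = 1" for i using unity_root_norm[OF assms(1)] assms(2) by (auto simp: phases_def)
  have "of_real (path_weight h xs) * character \<omega> (displacement xs) = (\<Prod>s\<leftarrow>xs. g s)" for xs
    by (induction xs) (auto simp: path_weight_def g_def character_add nz)
  then have "(\<Sum>xs | length xs = n. of_real (path_weight h xs) * character \<omega> (displacement xs))
      = (\<Sum>s\<in>UNIV. g s) ^ n"
    by (simp add: sum_lists_prod_list)
  also have "(\<Sum>s\<in>UNIV. g s) = (\<Sum>i\<in>UNIV. \<Sum>b\<in>UNIV. g (i, b))"
    by (simp add: sum.cartesian_product)
  also have "\<dots> = (\<Sum>i\<in>UNIV. of_real (h $ i * Re (\<omega> i)))"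
  proof (rule sum.cong)
    fix i
    have "(\<Sum>b\<in>UNIV. g (i, b)) = of_real (h $ i / 2) * (\<omega> i + cnj (\<omega> i))"
      by (simp add: UNIV_bool g_def character_step_vector nrm ring_distribs)
    then show "(\<Sum>b\<in>UNIV. g (i, b)) = of_real (h $ i * Re (\<omega> i))"
      by (simp add: complex_add_cnj)
  qed simp
  also have "\<dots> = of_real (Re (rotor h \<omega>))" by (simp add: rotor_def)
  finally show ?thesis by simp
qed

text \<open>
  Fourier inversion: the character sum in \<open>sum_character\<close> is the indicator of a closed path,
  because \<open>n < N\<close> steps cannot wrap around the torus.
\<close>
lemma return_prob_fourier:
  fixes h :: "real ^ 'd"
  assumes "n < N"
  shows "real N ^ CARD('d) * return_prob h n = (\<Sum>\<omega>\<in>phases N. Re (rotor h \<omega>) ^ n)"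
proof -
  have N: "N > 0" using assms by simp
  have fin: "finite {xs :: ('d \<times> bool) list. length xs = n}"
    using finite_lists_of_length[of n "\<lambda>_. True"] by simp
  have "of_real (\<Sum>\<omega>\<in>phases N. Re (rotor h \<omega>) ^ n)
      = (\<Sum>\<omega>\<in>phases N. \<Sum>xs | length xs = n. of_real (path_weight h xs) * character \<omega> (displacement xs))"
    using N by (simp add: sum_paths_character)
  also have "\<dots> = (\<Sum>xs | length xs = n. of_real (path_weight h xs) * (\<Sum>\<omega>\<in>phases N. character \<omega> (displacement xs)))"
    by (subst sum.swap) (simp add: sum_distrib_left)
  also have "\<dots> = (\<Sum>xs | length xs = n. of_real (path_weight h xs) *
      (if displacement xs = 0 then of_nat N ^ CARD('d) else 0))"
  proof (rule sum.cong)
    fix xs :: "('d \<times> bool) list" assume "xs \<in> {xs. length xs = n}"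
    then have "\<bar>displacement xs $ i\<bar> < int N" for i
      using abs_displacement_le[of xs i] assms by simp
    then show "of_real (path_weight h xs) * (\<Sum>\<omega>\<in>phases N. character \<omega> (displacement xs))
      = of_real (path_weight h xs) * (if displacement xs = 0 then of_nat N ^ CARD('d) else 0 :: complex)"
      using sum_character[OF N, of "displacement xs"] by simp
  qed simp
  also have "\<dots> = (\<Sum>xs | length xs = n \<and> displacement xs = 0. of_real (path_weight h xs) * of_nat N ^ CARD('d))"
    by (rule sum.mono_neutral_cong_right) (use fin in auto)
  also have "\<dots> = of_real (real N ^ CARD('d) * return_prob h n)"
    by (simp add: return_prob_def sum_distrib_left mult.commute)
  finally show ?thesis by (simp only: of_real_eq_iff)
qed

section \<open>Factoring out the simple random walk on the integers\<close>

text \<open>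
  The probability that the simple random walk on the integers is at its starting point at
  time \<open>2 * n\<close>.
\<close>
definition line_return_prob :: "nat \<Rightarrow> real" where
  "line_return_prob n = real (2 * n choose n) / 4 ^ n"

text \<open>
  Expand \<open>((w + cnj w) / 2) ^ (2 * n)\<close> for \<open>w = \<zeta> * z\<close> by the binomial theorem: averaging over \<open>\<zeta>\<close>
  kills every term except the central one, since all exponents of \<open>\<zeta>\<close> are smaller than \<open>N\<close>
  in absolute value.
\<close>
lemma circle_average_Re_power:
  assumes "2 * n < N"
  shows "(\<Sum>\<zeta>\<in>unity_roots N. Re (\<zeta> * z) ^ (2 * n)) = real N * line_return_prob n * norm z ^ (2 * n)"
proof -
  have N: "N > 0" using assms by simp
  define a :: "nat \<Rightarrow> complex" where "a k = of_nat (2 * n choose k) * z ^ k * cnj z ^ (2 * n - k) / 4 ^ n" for k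
  have expand: "of_real (Re (\<zeta> * z) ^ (2 * n)) = (\<Sum>k\<le>2 * n. a k * \<zeta> powi (2 * int k - 2 * int n))"
    if "\<zeta> \<in> unity_roots N" for \<zeta>
  proof -
    have nrm: "norm \<zeta> = 1" using unity_root_norm[OF N that] .
    then have nz: "\<zeta> \<noteq> 0" by auto
    have inv: "cnj \<zeta> = inverse \<zeta>" using inverse_eq_cnj[OF nrm] by simp
    have Re_eq: "of_real (Re (\<zeta> * z)) = (\<zeta> * z + cnj (\<zeta> * z)) / 2"
      by (simp only: complex_add_cnj) simp
    have "of_real (Re (\<zeta> * z) ^ (2 * n)) = (\<zeta> * z + cnj (\<zeta> * z)) ^ (2 * n) / 4 ^ n"
      by (simp only: of_real_power Re_eq power_divide) (simp add: power_mult)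
    also have "\<dots> = (\<Sum>k\<le>2 * n. of_nat (2 * n choose k) * (\<zeta> * z) ^ k * cnj (\<zeta> * z) ^ (2 * n - k) / 4 ^ n)"
      by (simp only: binomial_ring sum_divide_distrib)
    also have "\<dots> = (\<Sum>k\<le>2 * n. a k * \<zeta> powi (2 * int k - 2 * int n))"
    proof (rule sum.cong)
      fix k assume k: "k \<in> {..2 * n}"
      have "\<zeta> powi (2 * int k - 2 * int n) = \<zeta> powi (int k - int (2 * n - k))"
        using k by (intro arg_cong2[where f = power_int]) auto
      also have "\<dots> = \<zeta> ^ k * cnj \<zeta> ^ (2 * n - k)"
        using nz by (simp add: power_int_diff inv divide_inverse power_inverse)
      finally show "of_nat (2 * n choose k) * (\<zeta> * z) ^ k * cnj (\<zeta> * z) ^ (2 * n - k) / 4 ^ n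
          = a k * \<zeta> powi (2 * int k - 2 * int n)"
        by (simp add: a_def power_mult_distrib)
    qed simp
    finally show ?thesis .
  qed
  have "of_real (\<Sum>\<zeta>\<in>unity_roots N. Re (\<zeta> * z) ^ (2 * n))
      = (\<Sum>\<zeta>\<in>unity_roots N. \<Sum>k\<le>2 * n. a k * \<zeta> powi (2 * int k - 2 * int n))"
    by (simp only: of_real_sum expand cong: sum.cong)
  also have "\<dots> = (\<Sum>k\<le>2 * n. a k * (\<Sum>\<zeta>\<in>unity_roots N. \<zeta> powi (2 * int k - 2 * int n)))"
    by (subst sum.swap) (simp add: sum_distrib_left)
  also have "\<dots> = (\<Sum>k\<le>2 * n. if k = n then a k * of_nat N else 0)"
  proof (rule sum.cong)
    fix k assume "k \<in> {..2 * n}"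
    then have "\<bar>2 * int k - 2 * int n\<bar> < int N" using assms by auto
    from sum_unity_roots_powi[OF N this]
    show "a k * (\<Sum>\<zeta>\<in>unity_roots N. \<zeta> powi (2 * int k - 2 * int n)) = (if k = n then a k * of_nat N else 0)"
      by simp
  qed simp
  also have "\<dots> = a n * of_nat N" by simp
  also have "\<dots> = of_real (real N * line_return_prob n * norm z ^ (2 * n))"
  proof -
    have "z ^ n * cnj z ^ n = of_real (norm z ^ (2 * n))"
      by (simp add: power_mult flip: power_mult_distrib complex_norm_square)
    then show ?thesis by (simp add: a_def line_return_prob_def)
  qed
  finally show ?thesis by (simp only: of_real_eq_iff)
qed

lemma rotor_rotate: "rotor h (\<lambda>i. \<zeta> * \<omega> i) = \<zeta> * rotor h \<omega>"
  by (simp add: rotor_def sum_distrib_left)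

text \<open>
  The set of phases is invariant under a common rotation, so the real part in the Fourier formula
  may first be averaged over all rotations of the rotor. This separates the one-dimensional factor
  from even moments of the modulus of the rotor.
\<close>
lemma return_prob_even:
  fixes h :: "real ^ 'd"
  assumes "2 * n < N"
  shows "real N ^ CARD('d) * return_prob h (2 * n)
    = line_return_prob n * (\<Sum>\<omega>\<in>phases N. norm (rotor h \<omega>) ^ (2 * n))"
proof -
  have N: "N > 0" using assms by simp
  define S where "S = (\<Sum>\<omega>\<in>phases N. Re (rotor h \<omega>) ^ (2 * n))"
  have rot: "(\<Sum>\<omega>\<in>phases N. Re (\<zeta> * rotor h \<omega>) ^ (2 * n)) = S" if "\<zeta> \<in> unity_roots N" for \<zeta>
    unfolding S_def
  proof (rule sum.reindex_bij_witness[where j = "\<lambda>\<omega> i. \<zeta> * \<omega> i" and i = "\<lambda>\<omega> i. \<omega> i / \<zeta>"])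
    have "\<zeta> \<noteq> 0" using unity_root_norm[OF N that] by auto
    then show "(\<lambda>i. \<zeta> * \<omega> i / \<zeta>) = \<omega>" "(\<lambda>i. \<zeta> * (\<omega> i / \<zeta>)) = \<omega>" for \<omega> :: "'d \<Rightarrow> complex" by auto
  qed (use that in \<open>auto simp: phases_def unity_roots_def power_mult_distrib power_divide rotor_rotate\<close>)
  have "real N * S = (\<Sum>\<zeta>\<in>unity_roots N. \<Sum>\<omega>\<in>phases N. Re (\<zeta> * rotor h \<omega>) ^ (2 * n))"
    using sum.cong[OF refl rot, of "unity_roots N" "\<lambda>\<zeta>. \<zeta>"] N by (simp only: sum_constant card_unity_roots)
  also have "\<dots> = real N * (line_return_prob n * (\<Sum>\<omega>\<in>phases N. norm (rotor h \<omega>) ^ (2 * n)))"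
    by (subst sum.swap) (simp only: circle_average_Re_power[OF assms] sum_distrib_left mult.assoc)
  finally have "S = line_return_prob n * (\<Sum>\<omega>\<in>phases N. norm (rotor h \<omega>) ^ (2 * n))"
    using N by simp
  then show ?thesis using return_prob_fourier[OF assms, of h] by (simp add: S_def)
qed

lemma norm_rotor_le_1:
  assumes "probability_vector h" "N > 0" "\<omega> \<in> phases N"
  shows "norm (rotor h \<omega>) \<le> 1"
proof -
  have "norm (rotor h \<omega>) \<le> (\<Sum>i\<in>UNIV. norm (h $ i *\<^sub>R \<omega> i))"
    unfolding rotor_def by (rule norm_sum)
  also have "\<dots> = (\<Sum>i\<in>UNIV. h $ i)"
    using assms by (intro sum.cong) (auto simp: probability_vector_def phases_def unity_root_norm[of N])
  finally show ?thesis using assms by (simp add: probability_vector_def)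
qed

lemma line_return_prob_pos: "line_return_prob n > 0"
  by (simp add: line_return_prob_def zero_less_binomial_iff)

text \<open>
  Write \<open>u k\<close> for the probability of being back at time \<open>2 * k\<close>. By the factorization it is a constant
  times \<open>line_return_prob k * s k\<close>, where \<open>s\<close> is a moment sequence of a quantity in \<open>[0, 1]\<close> and hence
  decreasing. Bounding \<open>s n\<close> by \<open>s (n - k)\<close> termwise turns the convolution on the left, multiplied
  by \<open>s n\<close>, into the renewal sum for \<open>u n\<close>.
\<close>
lemma first_return_line_convolution_le:
  fixes h :: "real ^ 'd"
  assumes "probability_vector h" and "n \<ge> 1"
  shows "(\<Sum>k=1..n. first_return_prob h (2 * k) * line_return_prob (n - k)) \<le> line_return_prob n"
proof -
  define N where "N = 2 * n + 1"
  have N: "N > 0" by (simp add: N_def)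
  define s where "s k = (\<Sum>\<omega>\<in>phases N. norm (rotor h \<omega>) ^ (2 * k))" for k
  define K where "K = real N ^ CARD('d)"
  have u: "K * return_prob h (2 * k) = line_return_prob k * s k" if "k \<le> n" for k
    unfolding s_def K_def using that by (intro return_prob_even) (simp add: N_def)
  have s_mono: "s n \<le> s k" if "k \<le> n" for k
    unfolding s_def
    using that norm_rotor_le_1[OF assms(1) N] by (intro sum_mono power_decreasing) auto
  \<comment> \<open>The trivial phase contributes 1.\<close>
  have s_pos: "s n > 0"
  proof -
    have "(\<lambda>_. 1) \<in> phases N" by (simp add: phases_def unity_roots_def)
    moreover have "rotor h (\<lambda>_. 1) = 1"
      using assms(1) by (simp add: rotor_def probability_vector_def scaleR_conv_of_real flip: of_real_sum)
    ultimately show ?thesis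
      unfolding s_def using N by (intro sum_pos2[where i = "\<lambda>_. 1"]) auto
  qed
  have "s n * (\<Sum>k=1..n. first_return_prob h (2 * k) * line_return_prob (n - k))
      \<le> (\<Sum>k=1..n. first_return_prob h (2 * k) * (line_return_prob (n - k) * s (n - k)))"
    unfolding sum_distrib_left
  proof (rule sum_mono)
    fix k assume "k \<in> {1..n}"
    have "first_return_prob h (2 * k) * line_return_prob (n - k) * s n
      \<le> first_return_prob h (2 * k) * line_return_prob (n - k) * s (n - k)"
      using line_return_prob_pos[of "n - k"]
      by (intro mult_left_mono s_mono mult_nonneg_nonneg first_return_prob_nonneg assms(1)) auto
    then show "s n * (first_return_prob h (2 * k) * line_return_prob (n - k))
      \<le> first_return_prob h (2 * k) * (line_return_prob (n - k) * s (n - k))"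
      by (simp add: mult_ac)
  qed
  also have "\<dots> = K * return_prob h (2 * n)"
    using renewal_equation_even[OF assms(2), of h]
    by (simp add: sum_distrib_left mult.left_commute flip: u)
  also have "\<dots> = s n * line_return_prob n" using u[of n] by simp
  finally show ?thesis using s_pos by simp
qed

section \<open>Majorization increases return probabilities\<close>

text \<open>
  The Fourier formula writes the return probability as a sum of even powers of linear forms
  in \<open>h\<close>.
\<close>
lemma convex_on_return_prob_even: "convex_on UNIV (\<lambda>h :: real ^ 'd. return_prob h (2 * n))"
proof (rule convex_onI)
  fix t :: real and x y :: "real ^ 'd"
  assume t: "0 < t" "t < 1"
  define N where "N = 2 * n + 1"
  define K where "K = real N ^ CARD('d)"
  have K: "K > 0" by (simp add: K_def N_def)
  have F: "K * return_prob h (2 * n) = (\<Sum>\<omega>\<in>phases N. Re (rotor h \<omega>) ^ (2 * n))" for h :: "real ^ 'd"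
    unfolding K_def by (rule return_prob_fourier) (simp add: N_def)
  have lin: "Re (rotor ((1 - t) *\<^sub>R x + t *\<^sub>R y) \<omega>) = (1 - t) * Re (rotor x \<omega>) + t * Re (rotor y \<omega>)" for \<omega>
    by (simp add: rotor_def sum.distrib sum_distrib_left algebra_simps sum_subtractf)
  have "K * return_prob ((1 - t) *\<^sub>R x + t *\<^sub>R y) (2 * n)
      \<le> (\<Sum>\<omega>\<in>phases N. (1 - t) * Re (rotor x \<omega>) ^ (2 * n) + t * Re (rotor y \<omega>) ^ (2 * n))"
    unfolding F lin
    using convex_onD[OF convex_power_even[of "2 * n"], of t] t by (intro sum_mono) simp
  also have "\<dots> = (1 - t) * (K * return_prob x (2 * n)) + t * (K * return_prob y (2 * n))"
    by (simp add: F sum.distrib sum_distrib_left)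
  also have "\<dots> = K * ((1 - t) * return_prob x (2 * n) + t * return_prob y (2 * n))"
    by (simp add: algebra_simps)
  finally show "return_prob ((1 - t) *\<^sub>R x + t *\<^sub>R y) (2 * n)
      \<le> (1 - t) * return_prob x (2 * n) + t * return_prob y (2 * n)"
    using K by simp
qed simp

lemma return_prob_permute:
  fixes h :: "real ^ 'd"
  assumes "p permutes UNIV"
  shows "return_prob (\<chi> i. h $ p i) n = return_prob h n"
proof -
  define N where "N = n + 1"
  then have nN: "n < N" by simp
  have bij: "bij p" using assms by (simp add: permutes_bij)
  have "(\<Sum>\<omega>\<in>phases N. Re (rotor (\<chi> i. h $ p i) \<omega>) ^ n) = (\<Sum>\<omega>\<in>phases N. Re (rotor h \<omega>) ^ n)"
  proof (rule sum.reindex_bij_witness[where j = "\<lambda>\<omega>. \<omega> \<circ> inv p" and i = "\<lambda>\<omega>. \<omega> \<circ> p"])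
    fix \<omega> :: "'d \<Rightarrow> complex"
    have "rotor h (\<omega> \<circ> inv p) = (\<Sum>i\<in>UNIV. h $ p i *\<^sub>R (\<omega> \<circ> inv p) (p i))"
      unfolding rotor_def by (rule sum.reindex_bij_betw[OF bij, symmetric])
    then show "Re (rotor h (\<omega> \<circ> inv p)) ^ n = Re (rotor (\<chi> i. h $ p i) \<omega>) ^ n"
      using permutes_inverses(2)[OF assms] by (simp add: rotor_def)
  qed (use permutes_inverses[OF assms] in \<open>auto simp: phases_def fun_eq_iff\<close>)
  then have "real N ^ CARD('d) * return_prob (\<chi> i. h $ p i) n = real N ^ CARD('d) * return_prob h n"
    by (simp only: return_prob_fourier[OF nN])
  then show ?thesis by (simp add: N_def)
qed

lemma decreasing_rearrangement_enumeration:
  fixes h :: "real ^ 'd"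
  obtains es where "distinct es" "set es = UNIV" "decreasing_rearrangement h = map (($) h) es"
    "sorted_wrt (\<ge>) (map (($) h) es)"
proof -
  obtain zs :: "'d list" where zs: "set zs = UNIV" "distinct zs"
    using finite_distinct_list[of "UNIV :: 'd set"] by auto
  have "mset_set (UNIV :: 'd set) = mset zs"
    using mset_set_set[OF zs(2)] zs(1) by simp
  then have "decreasing_rearrangement h = rev (sort (map (($) h) zs))"
    unfolding decreasing_rearrangement_def
    by (simp only: mset_map[symmetric] sorted_list_of_multiset_mset)
  also have "sort (map (($) h) zs) = map (($) h) (sort_key (($) h) zs)"
    by (rule properties_for_sort) auto
  finally have eq: "decreasing_rearrangement h = map (($) h) (rev (sort_key (($) h) zs))"
    by (simp add: rev_map)
  have "sorted_wrt (\<ge>) (rev (map (($) h) (sort_key (($) h) zs)))"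
    unfolding sorted_wrt_rev by simp
  then have "sorted_wrt (\<ge>) (map (($) h) (rev (sort_key (($) h) zs)))"
    by (simp add: rev_map)
  then show ?thesis by (rule that[of "rev (sort_key (($) h) zs)", rotated -1]) (use eq zs in auto)
qed

text \<open>
  Exchange argument: elements of \<open>S\<close> outside the set \<open>T\<close> of the top \<open>card S\<close> entries have values at most
  the smallest one taken on \<open>T\<close>, and there are as many of them as elements of \<open>T\<close> outside \<open>S\<close>.
\<close>
lemma sum_le_sum_largest:
  fixes f :: "'a \<Rightarrow> real"
  assumes es: "distinct es" "sorted_wrt (\<ge>) (map f es)" and S: "S \<subseteq> set es" "card S \<le> length es"
  shows "sum f S \<le> (\<Sum>i<card S. f (es ! i))"
proof (cases "card S = 0")
  case True
  have "finite S" using S(1) finite_subset by blast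
  then show ?thesis using True by simp
next
  case False
  define j where "j = card S"
  define T where "T = set (take j es)"
  \<comment> \<open>The smallest value among the top \<open>j\<close> entries separates \<open>S - T\<close> from \<open>T - S\<close>.\<close>
  define \<tau> where "\<tau> = f (es ! (j - 1))"
  have fin: "finite S" "finite T" using S(1) finite_subset by (auto simp: T_def)
  have dec: "f (es ! b) \<le> f (es ! a)" if "a \<le> b" "b < length es" for a b
    using es(2) that by (cases "a = b") (auto simp: sorted_wrt_iff_nth_less)
  have T_img: "T = (!) es ` {..<j}" using S(2) by (auto simp: T_def j_def nth_image[symmetric])
  have inj: "inj_on ((!) es) {..<j}" using es(1) S(2) by (auto simp: j_def inj_on_def nth_eq_iff_index_eq)
  have "card T = j" unfolding T_img using inj by (simp add: card_image)
  then have cards: "card (S - T) = card (T - S)"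
    using fin by (simp add: card_Diff_subset_Int j_def Int_commute)
  have "f x \<le> \<tau>" if "x \<in> S - T" for x
  proof -
    have "x \<in> set es" using that S(1) by auto
    then obtain i where i: "i < length es" "x = es ! i" by (auto simp: in_set_conv_nth)
    then have "\<not> i < j" using that T_img by auto
    then show ?thesis unfolding \<tau>_def i(2) using i(1) by (intro dec) auto
  qed
  then have "sum f (S - T) \<le> of_nat (card (S - T)) * \<tau>" by (rule sum_bounded_above)
  also have "\<dots> = of_nat (card (T - S)) * \<tau>" by (simp add: cards)
  also have "\<dots> \<le> sum f (T - S)"
  proof (rule sum_bounded_below)
    fix x assume "x \<in> T - S"
    then obtain i where "i < j" "x = es ! i" using T_img by auto
    then show "\<tau> \<le> f x" unfolding \<tau>_def using S(2) False by (auto simp: j_def intro: dec)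
  qed
  finally have "sum f (S \<inter> T) + sum f (S - T) \<le> sum f (T \<inter> S) + sum f (T - S)" by (simp add: Int_commute)
  then have "sum f S \<le> sum f T" using fin by (simp add: sum.Int_Diff[symmetric])
  also have "sum f T = (\<Sum>i<j. f (es ! i))" unfolding T_img by (simp add: sum.reindex[OF inj])
  finally show ?thesis by (simp add: j_def)
qed

text \<open>
  Summation by parts; the equality of the totals makes up for the possibly negative last weight.
\<close>
lemma abel_summation_le:
  fixes w y z :: "nat \<Rightarrow> real"
  assumes dec: "\<And>i j. i \<le> j \<Longrightarrow> j < n \<Longrightarrow> w j \<le> w i"
    and partial: "\<And>j. j < n \<Longrightarrow> (\<Sum>i<j. y i) \<le> (\<Sum>i<j. z i)"
    and total: "(\<Sum>i<n. y i) = (\<Sum>i<n. z i)"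
  shows "(\<Sum>i<n. w i * y i) \<le> (\<Sum>i<n. w i * z i)"
proof -
  define Z where "Z j = (\<Sum>i<j. z i - y i)" for j
  have Z: "Z j \<ge> 0" if "j < n" for j using partial[OF that] by (simp add: Z_def sum_subtractf)
  \<comment> \<open>The induction trades \<open>w m\<close> for the smaller weight \<open>w (Suc m)\<close> on a nonnegative partial sum.\<close>
  have "w m * Z (Suc m) \<le> (\<Sum>i<Suc m. w i * (z i - y i))" if "m < n" for m
    using that
  proof (induction m)
    case (Suc m)
    have "w (Suc m) * Z (Suc m) \<le> w m * Z (Suc m)"
      using Suc.prems by (intro mult_right_mono dec Z) auto
    with Suc show ?case by (simp add: Z_def algebra_simps)
  qed (simp add: Z_def)
  from this[of "n - 1"] show ?thesis
    using total by (cases n) (simp_all add: Z_def sum_subtractf right_diff_distrib)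
qed

text \<open>
  Rado's theorem. A point outside the hull of the permutations of \<open>h'\<close> would be separated from it
  by a linear functional \<open>v\<close>. But among those permutations there is one ordered like \<open>v\<close>, and on it
  the functional is at least as large as on \<open>h''\<close>, by summation by parts against the partial sums
  that define majorization.
\<close>
lemma majorized_in_convex_hull_permutations:
  fixes h' h'' :: "real ^ 'd"
  assumes "h' \<succeq>\<^sub>m h''"
  shows "h'' \<in> convex hull {\<chi> i. h' $ p i | p. p permutes UNIV}"
proof (rule ccontr)
  define K where "K = {\<chi> i. h' $ p i | p. p permutes (UNIV :: 'd set)}"
  define d where "d = CARD('d)"
  assume "h'' \<notin> convex hull {\<chi> i. h' $ p i | p. p permutes UNIV}"
  then have notin: "h'' \<notin> convex hull K" by (simp add: K_def)
  have "finite K"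
    using finite_imageI[OF finite_permutations[of "UNIV :: 'd set"], of "\<lambda>p. \<chi> i. h' $ p i"]
    by (simp add: K_def setcompr_eq_image)
  then have "closed (convex hull K)"
    by (simp add: compact_imp_closed finite_imp_compact_convex_hull)
  from separating_hyperplane_closed_point[OF convex_convex_hull this notin]
  obtain a b where ab: "a \<bullet> h'' < b" "\<And>x. x \<in> convex hull K \<Longrightarrow> a \<bullet> x > b" by blast
  define v where "v = - a"
  obtain ls where ls: "distinct ls" "set ls = UNIV" "sorted_wrt (\<ge>) (map (($) v) ls)"
    using decreasing_rearrangement_enumeration[of v] by metis
  obtain es' where es': "distinct es'" "set es' = UNIV" "decreasing_rearrangement h' = map (($) h') es'"
    using decreasing_rearrangement_enumeration[of h'] by metis
  obtain es'' where es'': "distinct es''" "set es'' = UNIV" "decreasing_rearrangement h'' = map (($) h'') es''"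
     "sorted_wrt (\<ge>) (map (($) h'') es'')"
    using decreasing_rearrangement_enumeration[of h''] by metis
  have len: "length ls = d" "length es' = d" "length es'' = d"
    using distinct_card[OF ls(1)] distinct_card[OF es'(1)] distinct_card[OF es''(1)] ls(2) es'(2) es''(2)
    by (simp_all add: d_def)
  have bij_ls: "bij_betw ((!) ls) {..<d} UNIV"
    using bij_betw_nth[OF ls(1), of "{..<d}" UNIV] ls(2) len by simp
  have bij_es': "bij_betw ((!) es') {..<d} UNIV"
    using bij_betw_nth[OF es'(1), of "{..<d}" UNIV] es'(2) len by simp
  have bij_es'': "bij_betw ((!) es'') {..<d} UNIV"
    using bij_betw_nth[OF es''(1), of "{..<d}" UNIV] es''(2) len by simp
  \<comment> \<open>Puts the largest entry of \<open>h'\<close> where \<open>v\<close> is largest, and so on down.\<close>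
  define p where "p = (!) es' \<circ> the_inv_into {..<d} ((!) ls)"
  have "bij p"
    unfolding p_def using bij_betw_trans[OF bij_betw_the_inv_into[OF bij_ls] bij_es'] by simp
  then have perm: "p permutes UNIV" by (intro bij_imp_permutes) auto
  have p_ls: "p (ls ! i) = es' ! i" if "i < d" for i
    using that bij_ls by (simp add: p_def the_inv_into_f_f bij_betw_def)
  have index_shift: "(\<Sum>i=1..j. map f es ! (i - 1)) = (\<Sum>i<j. f (es ! i))"
    if "j \<le> length es" for j and f :: "'d \<Rightarrow> real" and es
  proof -
    have "(\<Sum>i=1..j. map f es ! (i - 1)) = (\<Sum>i<j. map f es ! i)"
      by (rule sum.reindex_bij_witness[where i = Suc and j = "\<lambda>i. i - 1"]) auto
    then show ?thesis using that by simp
  qed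
  have top: "(\<Sum>i<j. h'' $ (es'' ! i)) \<le> (\<Sum>i<j. h' $ (es' ! i))" if "j < d" for j
  proof (cases "j = 0")
    case False
    then have "j \<in> {1..CARD('d) - 1}" using that by (auto simp: d_def)
    then have "(\<Sum>i=1..j. map (($) h'') es'' ! (i - 1)) \<le> (\<Sum>i=1..j. map (($) h') es' ! (i - 1))"
      using assms unfolding majorizes_def es'(3) es''(3) by blast
    then show ?thesis using that len by (simp only: index_shift less_imp_le)
  qed simp
  have total: "(\<Sum>i<d. h'' $ (es'' ! i)) = (\<Sum>i<d. h' $ (es' ! i))"
  proof -
    have "(\<Sum>i=1..d. map (($) h'') es'' ! (i - 1)) = (\<Sum>i=1..d. map (($) h') es' ! (i - 1))"
      using assms unfolding majorizes_def es'(3) es''(3) d_def by (elim conjE sym)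
    then show ?thesis using len by (simp only: index_shift order_refl)
  qed
  have "(\<Sum>i<d. v $ (ls ! i) * h'' $ (ls ! i)) \<le> (\<Sum>i<d. v $ (ls ! i) * h' $ (es' ! i))"
  proof (rule abel_summation_le)
    show "v $ (ls ! j) \<le> v $ (ls ! i)" if "i \<le> j" "j < d" for i j
      using ls(3) len that by (cases "i = j") (auto simp: sorted_wrt_iff_nth_less)
    show "(\<Sum>i<j. h'' $ (ls ! i)) \<le> (\<Sum>i<j. h' $ (es' ! i))" if "j < d" for j
    proof -
      have inj: "inj_on ((!) ls) {..<j}"
        using bij_ls that by (auto simp: bij_betw_def inj_on_def)
      have "(\<Sum>i<j. h'' $ (ls ! i)) = sum (($) h'') ((!) ls ` {..<j})"
        by (simp add: sum.reindex[OF inj])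
      also have "\<dots> \<le> (\<Sum>i<j. h'' $ (es'' ! i))"
        using sum_le_sum_largest[OF es''(1,4), of "(!) ls ` {..<j}"] es''(2) that len
        by (simp add: card_image[OF inj])
      finally show ?thesis using top[OF that] by simp
    qed
    show "(\<Sum>i<d. h'' $ (ls ! i)) = (\<Sum>i<d. h' $ (es' ! i))"
      using sum.reindex_bij_betw[OF bij_ls, of "($) h''"] sum.reindex_bij_betw[OF bij_es'', of "($) h''"] total
      by simp
  qed
  moreover have "v \<bullet> h'' = (\<Sum>i<d. v $ (ls ! i) * h'' $ (ls ! i))"
    using sum.reindex_bij_betw[OF bij_ls, of "\<lambda>i. v $ i * h'' $ i"] by (simp add: inner_vec_def)
  moreover have "v \<bullet> (\<chi> i. h' $ p i) = (\<Sum>i<d. v $ (ls ! i) * h' $ (es' ! i))"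
    using sum.reindex_bij_betw[OF bij_ls, of "\<lambda>i. v $ i * h' $ p i"] by (simp add: inner_vec_def p_ls)
  moreover have "(\<chi> i. h' $ p i) \<in> convex hull K"
    using perm by (intro hull_inc) (auto simp: K_def)
  ultimately show False using ab by (force simp: v_def)
qed

text \<open>
  A convex symmetric function is bounded on the convex hull of the permutations of \<open>h'\<close> by its
  value at \<open>h'\<close>.
\<close>
lemma return_prob_even_mono_majorizes:
  fixes h' h'' :: "real ^ 'd"
  assumes "h' \<succeq>\<^sub>m h''"
  shows "return_prob h'' (2 * n) \<le> return_prob h' (2 * n)"
proof -
  let ?K = "{\<chi> i. h' $ p i | p. p permutes (UNIV :: 'd set)}"
  have "\<forall>h\<in>convex hull ?K. return_prob h (2 * n) \<le> return_prob h' (2 * n)"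
    using convex_on_subset[OF convex_on_return_prob_even subset_UNIV convex_convex_hull]
    by (intro convex_on_convex_hull_bound) (auto simp: return_prob_permute)
  then show ?thesis using majorized_in_convex_hull_permutations[OF assms] by blast
qed

section \<open>Comparison of first return probabilities\<close>

lemma line_return_prob_gbinomial: "line_return_prob n = (- 1) ^ n * ((- 1 / 2) gchoose n)"
proof (induction n)
  case (Suc n)
  define r :: real where "r = (2 * real n + 1) / (2 * real n + 2)"
  have "line_return_prob (Suc n) = line_return_prob n * r"
  proof -
    have b1: "real (2 * n choose n) = fact (2 * n) / (fact n * fact n)"
      by (subst binomial_fact) auto
    have b2: "real (2 * Suc n choose Suc n) = fact (2 * n) * (2 * real n + 1) * (2 * real n + 2)
        / ((real n + 1) * fact n * ((real n + 1) * fact n))"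
      by (subst binomial_fact) (auto simp: algebra_simps)
    show ?thesis unfolding line_return_prob_def b1 b2 power_Suc r_def
      by (simp add: divide_simps) (simp add: algebra_simps)
  qed
  moreover have "((- 1 / 2) gchoose Suc n) = ((- 1 / 2) gchoose n) * (- r)"
  proof -
    have "(real n + 1) * ((- 1 / 2) gchoose Suc n) = (- 1 / 2 - real n) * ((- 1 / 2) gchoose n)"
      using gbinomial_mult_1[of "- 1 / 2 :: real" n] by (simp add: algebra_simps)
    also have "- 1 / 2 - real n = - r * (real n + 1)" by (simp add: r_def divide_simps) (simp add: algebra_simps)
    finally have "(real n + 1) * ((- 1 / 2) gchoose Suc n) = (real n + 1) * (((- 1 / 2) gchoose n) * (- r))"
      by (simp only: mult_ac)
    then show ?thesis by (simp only: mult_cancel_left) simp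
  qed
  ultimately show ?case by (simp only: Suc) simp
qed (simp add: line_return_prob_def)

text \<open>
  The generating function of \<open>line_return_prob\<close> is \<open>(1 - z) powr (- 1 / 2)\<close>; its square is the
  geometric series.
\<close>
lemma line_return_prob_convolution:
  "(\<Sum>k=0..n. line_return_prob k * line_return_prob (n - k)) = 1"
proof -
  have "(\<Sum>k=0..n. line_return_prob k * line_return_prob (n - k))
      = (\<Sum>k=0..n. (- 1) ^ n * (((- 1 / 2) gchoose k) * ((- 1 / 2) gchoose (n - k))))"
    by (intro sum.cong) (auto simp: line_return_prob_gbinomial simp flip: power_add)
  also have "\<dots> = (- 1) ^ n * ((- 1) gchoose n)"
    using gbinomial_Vandermonde[of "- 1 / 2 :: real" "- 1 / 2" n] by (simp flip: sum_distrib_left)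
  also have "\<dots> = 1" by (simp add: gbinomial_minus flip: binomial_gbinomial)
  finally show ?thesis .
qed

lemma fps_mult_nonneg:
  fixes f g :: "real fps"
  assumes "\<And>n. fps_nth f n \<ge> 0" "\<And>n. fps_nth g n \<ge> 0"
  shows "fps_nth (f * g) n \<ge> 0"
  unfolding fps_mult_nth by (intro sum_nonneg mult_nonneg_nonneg assms)

definition return_fps :: "real ^ 'd \<Rightarrow> real fps" where
  "return_fps h = Abs_fps (\<lambda>n. return_prob h (2 * n))"

definition first_return_fps :: "real ^ 'd \<Rightarrow> real fps" where
  "first_return_fps h = Abs_fps (\<lambda>n. first_return_prob h (2 * n))"

definition line_fps :: "real fps" where
  "line_fps = Abs_fps line_return_prob"

lemma return_fps_inverse: "return_fps h * (1 - first_return_fps h) = 1"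
proof -
  have "return_fps h = 1 + first_return_fps h * return_fps h"
  proof (rule fps_ext)
    fix n
    show "fps_nth (return_fps h) n = fps_nth (1 + first_return_fps h * return_fps h) n"
    proof (cases "n = 0")
      case False
      then have "return_prob h (2 * n)
          = (\<Sum>k=0..n. first_return_prob h (2 * k) * return_prob h (2 * (n - k)))"
        using renewal_equation_even[of n h] by (simp add: sum.atLeast_Suc_atMost)
      then show ?thesis using False by (simp add: return_fps_def first_return_fps_def fps_mult_nth)
    qed (simp add: return_fps_def first_return_fps_def)
  qed
  then show ?thesis by (simp add: algebra_simps)
qed

lemma line_fps_times_one_minus_first_return_nonneg:
  assumes "probability_vector h"
  shows "fps_nth (line_fps * (1 - first_return_fps h)) n \<ge> 0"
proof (cases "n = 0")
  case True
  then show ?thesis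
    using line_return_prob_pos[of 0] by (simp add: line_fps_def first_return_fps_def)
next
  case False
  have "line_fps * (1 - first_return_fps h) = line_fps - first_return_fps h * line_fps"
    by (simp add: algebra_simps)
  then have "fps_nth (line_fps * (1 - first_return_fps h)) n
      = line_return_prob n - (\<Sum>k=0..n. first_return_prob h (2 * k) * line_return_prob (n - k))"
    by (simp only: fps_sub_nth) (simp add: line_fps_def first_return_fps_def fps_mult_nth)
  also have "(\<Sum>k=0..n. first_return_prob h (2 * k) * line_return_prob (n - k))
      = (\<Sum>k=1..n. first_return_prob h (2 * k) * line_return_prob (n - k))"
    by (simp add: sum.atLeast_Suc_atMost)
  finally show ?thesis using first_return_line_convolution_le[OF assms] False by simp
qed

text \<open>
  Partial sums are coefficients of the product with the geometric series, which is the square of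
  \<open>line_fps\<close>. Sharing out its two factors between the two walks leaves a product of three series
  with nonnegative coefficients.
\<close>
lemma first_return_cumulative_mono_majorizes:
  fixes h' h'' :: "real ^ 'd"
  assumes "probability_vector h'" "probability_vector h''" "h' \<succeq>\<^sub>m h''"
  shows "(\<Sum>k=0..n. first_return_prob h'' (2 * k)) \<le> (\<Sum>k=0..n. first_return_prob h' (2 * k))"
proof -
  define U' U'' F' F'' where "U' = return_fps h'" and "U'' = return_fps h''"
    and "F' = first_return_fps h'" and "F'' = first_return_fps h''"
  have inv: "U' * (1 - F') = 1" "U'' * (1 - F'') = 1"
    unfolding U'_def U''_def F'_def F''_def by (rule return_fps_inverse)+
  have "F' - F'' = (U' * (1 - F')) * (1 - F'') - (U'' * (1 - F'')) * (1 - F')"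
    unfolding inv by simp
  also have "\<dots> = (U' - U'') * (1 - F') * (1 - F'')"
    by (simp add: algebra_simps)
  finally have diff: "F' - F'' = (U' - U'') * (1 - F') * (1 - F'')" .
  have "0 \<le> fps_nth ((U' - U'') * ((line_fps * (1 - F')) * (line_fps * (1 - F'')))) n"
    using return_prob_even_mono_majorizes[OF assms(3)]
    unfolding F'_def F''_def
    by (intro fps_mult_nonneg line_fps_times_one_minus_first_return_nonneg assms)
      (simp add: U'_def U''_def return_fps_def)
  also have "(U' - U'') * ((line_fps * (1 - F')) * (line_fps * (1 - F''))) = (F' - F'') * line_fps ^ 2"
    unfolding diff by (simp add: power2_eq_square mult_ac)
  also have "fps_nth \<dots> n = (\<Sum>k=0..n. fps_nth (F' - F'') k)"
  proof -
    have "fps_nth (line_fps ^ 2) k = 1" for k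
      using line_return_prob_convolution[of k] by (simp add: fps_mult_nth power2_eq_square line_fps_def)
    then show ?thesis by (simp only: fps_mult_nth[of "F' - F''"]) simp
  qed
  finally show ?thesis
    by (simp add: F'_def F''_def first_return_fps_def sum_subtractf)
qed

section \<open>The law of the first return time\<close>

lemma first_return_time_le_iff:
  "first_return_time X \<omega> \<le> enat n \<longleftrightarrow> (\<exists>m\<in>{1..n}. walk_position X m \<omega> = 0)"
proof
  let ?S = "{enat n | n. n \<ge> 1 \<and> walk_position X n \<omega> = 0}"
  assume le: "first_return_time X \<omega> \<le> enat n"
  have "?S \<noteq> {}"
  proof
    assume "?S = {}"
    then have "first_return_time X \<omega> = \<infinity>"
      unfolding first_return_time_def Inf_enat_def by (simp only: refl if_True)
    with le show False by simp
  qed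
  then have "Inf ?S \<in> ?S" unfolding Inf_enat_def by (auto intro: LeastI)
  then show "\<exists>m\<in>{1..n}. walk_position X m \<omega> = 0"
    using le unfolding first_return_time_def by force
next
  assume "\<exists>m\<in>{1..n}. walk_position X m \<omega> = 0"
  then obtain m where m: "1 \<le> m" "m \<le> n" "walk_position X m \<omega> = 0" by auto
  then have "first_return_time X \<omega> \<le> enat m"
    unfolding first_return_time_def by (intro Inf_lower) auto
  then show "first_return_time X \<omega> \<le> enat n" using m(2) by (meson enat_ord_simps(1) order_trans)
qed

lemma inj_step_vector: "inj step_vector"
proof (rule injI)
  fix s t :: "'d::finite \<times> bool" assume eq: "step_vector s = step_vector t"
  have "step_vector s $ fst s = step_vector t $ fst s" by (simp add: eq)
  then show "s = t" by (auto simp: step_vector_def axis_def prod_eq_iff split: if_splits)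
qed

text \<open>
  The shift by one skips \<open>X 0\<close>, which is not an increment of the walk.
\<close>
definition increment_list :: "(nat \<Rightarrow> 'a \<Rightarrow> 'b) \<Rightarrow> nat \<Rightarrow> 'a \<Rightarrow> 'b list" where
  "increment_list X n \<omega> = map (\<lambda>k. X (Suc k) \<omega>) [0..<n]"

lemma walk_position_increment_list:
  assumes "m \<le> n"
  shows "walk_position X m \<omega> = sum_list (take m (increment_list X n \<omega>))"
proof -
  have "sum_list (take m (increment_list X n \<omega>)) = (\<Sum>k\<leftarrow>[0..<m]. X (Suc k) \<omega>)"
    using assms by (simp add: increment_list_def take_map)
  also have "\<dots> = (\<Sum>k=0..<m. X (Suc k) \<omega>)" by (simp add: interv_sum_list_conv_sum_set_nat)
  also have "\<dots> = walk_position X m \<omega>"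
    unfolding walk_position_def
    by (rule sum.reindex_bij_witness[where j = Suc and i = "\<lambda>k. k - 1"]) auto
  finally show ?thesis by simp
qed

lemma increment_list_eq_iff:
  assumes "length l = n"
  shows "increment_list X n \<omega> = l \<longleftrightarrow> (\<forall>k<n. X (Suc k) \<omega> = l ! k)"
proof -
  have "length (increment_list X n \<omega>) = n" "\<And>k. k < n \<Longrightarrow> increment_list X n \<omega> ! k = X (Suc k) \<omega>"
    by (simp_all add: increment_list_def)
  then show ?thesis using assms by (simp only: list_eq_iff_nth_eq) simp
qed

context lattice_walk
begin

lemma measurable_increment: "k \<ge> 1 \<Longrightarrow> X k \<in> M \<rightarrow>\<^sub>M count_space UNIV"
  using indep_increments by (auto simp: indep_vars_def)

lemma measurable_increment_list: "increment_list X n \<in> M \<rightarrow>\<^sub>M count_space UNIV"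
proof -
  have "increment_list X n -` {l} \<inter> space M \<in> sets M" for l
  proof (cases "length l = n")
    case True
    have [measurable]: "X (Suc k) \<in> M \<rightarrow>\<^sub>M count_space UNIV" for k by (rule measurable_increment) simp
    have "increment_list X n -` {l} \<inter> space M = {\<omega>\<in>space M. \<forall>k<n. X (Suc k) \<omega> = l ! k}"
      by (simp add: vimage_def Int_def conj_commute increment_list_eq_iff[OF True])
    also have "\<dots> \<in> sets M" by measurable
    finally show ?thesis .
  next
    case False
    then have "increment_list X n -` {l} \<inter> space M = {}" by (auto simp: increment_list_def)
    then show ?thesis by simp
  qed
  then show ?thesis by (subst measurable_count_space_eq2_countable) auto
qed

lemma prob_increment: "k \<ge> 1 \<Longrightarrow> \<P>(\<omega> in M. X k \<omega> = step_vector s) = h $ fst s / 2"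
  using increment_pos increment_neg by (simp add: step_vector_def)

lemma prob_increment_list_eq:
  assumes "length xs = n"
  shows "\<P>(\<omega> in M. increment_list X n \<omega> = map step_vector xs) = path_weight h xs"
proof (cases "n = 0")
  case True
  then show ?thesis using assms by (simp add: increment_list_def prob_space)
next
  case False
  have iff: "increment_list X n \<omega> = map step_vector xs
      \<longleftrightarrow> (\<forall>k\<in>{1..n}. X k \<omega> = step_vector (xs ! (k - 1)))" for \<omega>
  proof -
    have "{1..n} = Suc ` {..<n}" by (simp only: image_Suc_lessThan)
    then show ?thesis using assms by (simp only:) (auto simp: increment_list_eq_iff)
  qed
  have "{\<omega>\<in>space M. increment_list X n \<omega> = map step_vector xs}
      = (\<Inter>k\<in>{1..n}. X k -` {step_vector (xs ! (k - 1))} \<inter> space M)"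
    unfolding iff using False by auto
  then have "\<P>(\<omega> in M. increment_list X n \<omega> = map step_vector xs)
      = (\<Prod>k\<in>{1..n}. prob (X k -` {step_vector (xs ! (k - 1))} \<inter> space M))"
    using indep_varsD[OF indep_increments, of "{1..n}" "\<lambda>k. {step_vector (xs ! (k - 1))}"] False by auto
  also have "\<dots> = (\<Prod>k\<in>{1..n}. h $ fst (xs ! (k - 1)) / 2)"
  proof (rule prod.cong)
    fix k assume "k \<in> {1..n}"
    then show "prob (X k -` {step_vector (xs ! (k - 1))} \<inter> space M) = h $ fst (xs ! (k - 1)) / 2"
      using prob_increment[of k "xs ! (k - 1)"] by (simp add: vimage_def Int_def conj_commute)
  qed simp
  also have "\<dots> = (\<Prod>k=0..<n. h $ fst (xs ! k) / 2)"
    by (rule prod.reindex_bij_witness[where i = Suc and j = "\<lambda>k. k - 1"]) auto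
  also have "\<dots> = path_weight h xs"
    using assms by (simp add: path_weight_def prod.list_conv_set_nth)
  finally show ?thesis .
qed

text \<open>
  Only the probabilities of words made of unit steps are known. They add up to 1, so almost surely
  the increments form such a word and all other values can be ignored.
\<close>
lemma prob_increment_list_in:
  assumes "probability_vector h"
  shows "\<P>(\<omega> in M. increment_list X n \<omega> \<in> A)
    = (\<Sum>xs | length xs = n \<and> map step_vector xs \<in> A. path_weight h xs)"
proof -
  define E where "E xs = {\<omega>\<in>space M. increment_list X n \<omega> = map step_vector xs}" for xs
  define B where "B = {\<omega>\<in>space M. increment_list X n \<omega> \<in> A}"
  have [measurable]: "increment_list X n \<in> M \<rightarrow>\<^sub>M count_space UNIV"
    by (rule measurable_increment_list)
  have E_ev: "E xs \<in> events" for xs unfolding E_def by measurable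
  have B_ev: "B \<in> events" unfolding B_def by measurable
  have fin: "finite {xs :: ('d \<times> bool) list. length xs = n}"
    using finite_lists_of_length[of n "\<lambda>_. True"] by simp
  have disj: "disjoint_family_on E S" for S
    unfolding disjoint_family_on_def E_def
    by (auto dest: injD[OF inj_mapI[OF inj_step_vector]])
  have prob_E: "prob (E xs) = path_weight h xs" if "length xs = n" for xs
    unfolding E_def by (rule prob_increment_list_eq[OF that])
  have "prob (\<Union>xs\<in>{xs. length xs = n}. E xs) = (\<Sum>xs | length xs = n. path_weight h xs)"
    using finite_measure_finite_Union[OF fin _ disj, of] E_ev prob_E by (simp add: image_subset_iff)
  also have "\<dots> = (\<Sum>s\<in>(UNIV :: ('d \<times> bool) set). h $ fst s / 2) ^ n"
    unfolding path_weight_def by (rule sum_lists_prod_list)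
  also have "(\<Sum>s\<in>(UNIV :: ('d \<times> bool) set). h $ fst s / 2) = (\<Sum>i\<in>UNIV. \<Sum>b\<in>(UNIV :: bool set). h $ i / 2)"
    by (simp only: UNIV_Times_UNIV[symmetric] sum.cartesian_product case_prod_unfold)
  also have "\<dots> = 1" using assms by (simp add: UNIV_bool probability_vector_def)
  finally have "AE \<omega> in M. \<omega> \<in> (\<Union>xs\<in>{xs. length xs = n}. E xs)"
    using prob_eq_1[of "\<Union>xs\<in>{xs. length xs = n}. E xs"] E_ev fin by (simp add: sets.finite_UN)
  then have "AE \<omega> in M. \<omega> \<in> B \<longleftrightarrow> \<omega> \<in> (\<Union>xs\<in>{xs. length xs = n \<and> map step_vector xs \<in> A}. E xs)"
    by eventually_elim (auto simp: E_def B_def)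
  then have "prob B = prob (\<Union>xs\<in>{xs. length xs = n \<and> map step_vector xs \<in> A}. E xs)"
    using B_ev E_ev by (intro finite_measure_eq_AE) (auto intro!: sets.finite_UN)
  also have "\<dots> = (\<Sum>xs | length xs = n \<and> map step_vector xs \<in> A. path_weight h xs)"
    using finite_measure_finite_Union[OF finite_lists_of_length _ disj] E_ev prob_E
    by (simp add: image_subset_iff)
  finally show ?thesis by (simp add: B_def)
qed

text \<open>
  The event splits according to the value of the first return time, and each of the resulting events
  depends on finitely many increments only.
\<close>
lemma prob_first_return_time_le:
  assumes "probability_vector h"
  shows "\<P>(\<omega> in M. first_return_time X \<omega> \<le> enat n) = (\<Sum>k=0..n div 2. first_return_prob h (2 * k))"
proof -
  define A :: "(int ^ 'd) list set" where
    "A = {l. l \<noteq> [] \<and> sum_list l = 0 \<and> (\<forall>j\<in>{1..<length l}. sum_list (take j l) \<noteq> 0)}"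
  define R where "R k = {\<omega>\<in>space M. increment_list X k \<omega> \<in> A}" for k
  have len: "length (increment_list X k \<omega>) = k" for k \<omega> by (simp add: increment_list_def)
  have R_iff: "\<omega> \<in> R k \<longleftrightarrow> \<omega> \<in> space M \<and> 1 \<le> k \<and> walk_position X k \<omega> = 0 \<and>
      (\<forall>j\<in>{1..<k}. walk_position X j \<omega> \<noteq> 0)" for k \<omega>
  proof -
    have "increment_list X k \<omega> \<noteq> [] \<longleftrightarrow> 1 \<le> k" using len[of k \<omega>] by (cases k) auto
    moreover have "walk_position X k \<omega> = sum_list (increment_list X k \<omega>)"
      using walk_position_increment_list[of k k X \<omega>] len[of k \<omega>] by simp
    moreover have "walk_position X j \<omega> = sum_list (take j (increment_list X k \<omega>))" if "j \<in> {1..<k}" for j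
      using that by (intro walk_position_increment_list) auto
    ultimately show ?thesis by (auto simp: R_def A_def len)
  qed
  have R_ev: "R k \<in> events" for k
  proof -
    have [measurable]: "increment_list X k \<in> M \<rightarrow>\<^sub>M count_space UNIV" by (rule measurable_increment_list)
    show ?thesis unfolding R_def by measurable
  qed
  have disj: "disjoint_family_on R {1..n}"
    unfolding disjoint_family_on_def
  proof (intro ballI impI)
    fix j k assume jk: "j \<in> {1..n}" "k \<in> {1..n}" "j \<noteq> k"
    then have "j < k \<or> k < j" by auto
    then show "R j \<inter> R k = {}" using jk by (auto simp: R_iff)
  qed
  have "{\<omega>\<in>space M. first_return_time X \<omega> \<le> enat n} = (\<Union>k\<in>{1..n}. R k)"
  proof (intro set_eqI iffI)
    fix \<omega> assume "\<omega> \<in> {\<omega>\<in>space M. first_return_time X \<omega> \<le> enat n}"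
    then obtain m where m: "\<omega> \<in> space M" "m \<in> {1..n}" "walk_position X m \<omega> = 0"
      by (auto simp: first_return_time_le_iff)
    define k where "k = (LEAST k. 1 \<le> k \<and> walk_position X k \<omega> = 0)"
    have "1 \<le> k \<and> walk_position X k \<omega> = 0"
      unfolding k_def by (rule LeastI[of _ m]) (use m in auto)
    moreover have "k \<le> m" unfolding k_def by (rule Least_le) (use m in auto)
    moreover have "walk_position X j \<omega> \<noteq> 0" if "j \<in> {1..<k}" for j
      using not_less_Least[of j "\<lambda>k. 1 \<le> k \<and> walk_position X k \<omega> = 0"] that by (auto simp: k_def)
    ultimately have "\<omega> \<in> R k" "k \<in> {1..n}" using m by (auto simp: R_iff)
    then show "\<omega> \<in> (\<Union>k\<in>{1..n}. R k)" by blast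
  next
    fix \<omega> assume "\<omega> \<in> (\<Union>k\<in>{1..n}. R k)"
    then show "\<omega> \<in> {\<omega>\<in>space M. first_return_time X \<omega> \<le> enat n}"
      by (auto simp: first_return_time_le_iff R_iff)
  qed
  then have "\<P>(\<omega> in M. first_return_time X \<omega> \<le> enat n) = (\<Sum>k\<in>{1..n}. prob (R k))"
    using finite_measure_finite_Union[OF _ _ disj] R_ev by (simp add: image_subset_iff)
  also have "\<dots> = (\<Sum>k\<in>{1..n}. first_return_prob h k)"
  proof (rule sum.cong)
    fix k
    have "map step_vector xs \<in> A \<longleftrightarrow> first_return xs" for xs
      by (simp add: A_def first_return_def displacement_def take_map)
    then show "prob (R k) = first_return_prob h k"
      unfolding R_def first_return_prob_def using prob_increment_list_in[OF assms, of k A] by simp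
  qed simp
  also have "\<dots> = (\<Sum>k\<in>(*) 2 ` {0..n div 2}. first_return_prob h k)"
  proof (rule sum.mono_neutral_cong)
    fix k assume k: "k \<in> {1..n} - (*) 2 ` {0..n div 2}"
    have "odd k"
    proof
      assume "even k"
      then obtain m where "k = 2 * m" by auto
      then show False using k by auto
    qed
    then show "first_return_prob h k = 0" by (rule first_return_prob_odd)
  next
    fix k assume "k \<in> (*) 2 ` {0..n div 2} - {1..n}"
    then have "k = 0" by auto
    then show "first_return_prob h k = 0" by simp
  qed auto
  also have "\<dots> = (\<Sum>k=0..n div 2. first_return_prob h (2 * k))"
    by (subst sum.reindex) (auto simp: inj_on_def)
  finally show ?thesis .
qed

end

theorem theorem1:
  fixes h' h'' :: "real ^ 'd"
    and M' :: "'a measure" and X' :: "nat \<Rightarrow> 'a \<Rightarrow> int ^ 'd"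
    and M'' :: "'b measure" and X'' :: "nat \<Rightarrow> 'b \<Rightarrow> int ^ 'd"
  assumes "probability_vector h'" and "probability_vector h''"
    and "h' \<succ>\<^sub>m h''"
    and "lattice_walk M' h' X'" and "lattice_walk M'' h'' X''"
  shows "\<forall>n::nat. n \<ge> 1 \<longrightarrow>
           \<P>(\<omega> in M'. first_return_time X' \<omega> \<le> enat n)
             \<ge> \<P>(\<omega> in M''. first_return_time X'' \<omega> \<le> enat n)"
  using first_return_cumulative_mono_majorizes[OF assms(1,2)] assms(3)
    lattice_walk.prob_first_return_time_le[OF assms(4,1)]
    lattice_walk.prob_first_return_time_le[OF assms(5,2)]
  by (simp add: strictly_majorizes_def)

end
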